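(* Let $\ell\geq 1$ be an integer. Then, for all integers $n\geq \ell+2$, $$\ell\left(\frac{n}{n-1}\right)^{n-\ell-2} + \sum_{k=\ell}^{n-2}\left(\frac{n}{n-1}\right)^{n-k-2} \left(\frac{n-k-\ell-2}{n-\ell-1}+\frac{(\ell+1)\,nk+\ell\,(n-k-2)}{n\,(n-1)\,(n-\ell-1)}\right) = n-2.$$
   Context: The identity is between rational numbers. *)

theory Defs
  imports Complex_Main
begin

end

theory Submission imports Defs begin

text \<open>
  The sum telescopes. Write \<open>r = n / (n - 1)\<close>. The factor multiplying \<open>r powi (n - k - 2)\<close> in the
  summand is affine in \<open>k\<close>, so one looks for an antidifference of the form
  \<open>r powi (n - k - 1) * L k\<close> with \<open>L\<close> affine; its forward difference is
  \<open>r powi (n - k - 2) * (L (k + 1) - r * L k)\<close>. The sum then equals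
  \<open>L (n - 1) - r powi (n - l - 1) * L l\<close>, and this cancels the leading term and leaves \<open>n - 2\<close>
  when \<open>L l = l / r\<close> and \<open>L (n - 1) = n - 2\<close>. These two values determine \<open>L\<close>, and the bracket in
  the summand is exactly \<open>L (k + 1) - r * L k\<close> for this \<open>L\<close> (lemma \<open>summand_factor_conv_interp\<close>).
\<close>

lemma sum_int_telescope:
  fixes f :: "int \<Rightarrow> 'a :: ab_group_add"
  assumes "a \<le> b"
  shows "(\<Sum>k = a..b. f (k + 1) - f k) = f (b + 1) - f a"
  using assms
proof (induction b rule: int_ge_induct)
  case base
  show ?case by simp
next
  case (step b)
  then have "{a..b + 1} = insert (b + 1) {a..b}" by auto
  with step.IH show ?case by simp
qed

text \<open>
  For \<open>n \<noteq> l + 1\<close> this is the affine function of \<open>k\<close>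
  through the points \<open>(l, l (n - 1) / n)\<close> and \<open>(n - 1, n - 2)\<close>.
\<close>

definition interp :: "'a :: field \<Rightarrow> 'a \<Rightarrow> 'a \<Rightarrow> 'a" where
  "interp l n k = (l * (n - 1) / n * (n - 1 - k) + (n - 2) * (k - l)) / (n - l - 1)"

lemma interp_left:
  assumes "n - l - 1 \<noteq> 0"
  shows "interp l n l = l * (n - 1) / n"
proof -
  have "interp l n l = l * (n - 1) / n * (n - l - 1) / (n - l - 1)"
    by (simp add: interp_def diff_right_commute)
  with assms show ?thesis by simp
qed

lemma interp_right:
  assumes "n - l - 1 \<noteq> 0"
  shows "interp l n (n - 1) = n - 2"
proof -
  have "interp l n (n - 1) = (n - 2) * (n - l - 1) / (n - l - 1)"
    by (simp add: interp_def diff_right_commute)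
  with assms show ?thesis by simp
qed

lemma summand_factor_conv_interp:
  fixes l n k :: "'a :: field"
  assumes "n \<noteq> 0" "n - 1 \<noteq> 0" "n - l - 1 \<noteq> 0"
  shows "(n - k - l - 2) / (n - l - 1)
      + ((l + 1) * n * k + l * (n - k - 2)) / (n * (n - 1) * (n - l - 1))
    = interp l n (k + 1) - n / (n - 1) * interp l n k"
proof -
  \<comment> \<open>Naming the denominators keeps them atomic while fractions are cleared.\<close>
  define p d where "p = n - 1" and "d = n - l - 1"
  have nz: "n \<noteq> 0" "p \<noteq> 0" "d \<noteq> 0"
    using assms by (simp_all add: p_def d_def)
  have "(n - k - l - 2) / d + ((l + 1) * n * k + l * (n - k - 2)) / (n * p * d)
    = ((n - k - l - 2) * (n * p) + ((l + 1) * n * k + l * (n - k - 2))) / (n * p * d)"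
    using nz by (simp add: field_simps)
  also have "(n - k - l - 2) * (n * p) + ((l + 1) * n * k + l * (n - k - 2))
    = p * (l * p * (n - 2 - k) + n * (n - 2) * (k + 1 - l))
      - n * (l * p * (n - 1 - k) + n * (n - 2) * (k - l))"
    unfolding p_def by algebra
  also have "\<dots> / (n * p * d)
    = (l * p / n * (n - 2 - k) + (n - 2) * (k + 1 - l)) / d
      - n / p * ((l * p / n * (n - 1 - k) + (n - 2) * (k - l)) / d)"
    using nz by (simp add: divide_simps) algebra
  finally show ?thesis
    by (simp add: interp_def p_def d_def algebra_simps)
qed

theorem proposition3p1:
  fixes l n :: int
  assumes "l \<ge> 1" and "n \<ge> l + 2"
  shows "rat_of_int l * (rat_of_int n / rat_of_int (n - 1)) powi (n - l - 2)
    + (\<Sum>k = l..n - 2. (rat_of_int n / rat_of_int (n - 1)) powi (n - k - 2)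
        * (rat_of_int (n - k - l - 2) / rat_of_int (n - l - 1)
           + rat_of_int ((l + 1) * n * k + l * (n - k - 2))
               / rat_of_int (n * (n - 1) * (n - l - 1))))
    = rat_of_int (n - 2)"
proof -
  define N L r where "N = rat_of_int n" and "L = rat_of_int l" and "r = N / (N - 1)"
  have r_eq: "rat_of_int n / rat_of_int (n - 1) = r"
    by (simp add: r_def N_def)
  have "N - 1 = rat_of_int (n - 1)" "N - L - 1 = rat_of_int (n - l - 1)"
    by (simp_all add: N_def L_def)
  then have nz: "N \<noteq> 0" "N - 1 \<noteq> 0" "N - L - 1 \<noteq> 0"
    using assms unfolding N_def by (simp_all only: of_int_eq_0_iff)
  then have "r \<noteq> 0" by (simp add: r_def)
  have r_shift: "r powi (n - k - 1) = r powi (n - k - 2) * r" for k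
    using power_int_add_1[OF disjI1[OF \<open>r \<noteq> 0\<close>], of "n - k - 2"] by (simp add: algebra_simps)
  define H where "H k = r powi (n - k - 1) * interp L N (rat_of_int k)" for k
  have summand: "r powi (n - k - 2)
      * (rat_of_int (n - k - l - 2) / rat_of_int (n - l - 1)
         + rat_of_int ((l + 1) * n * k + l * (n - k - 2))
             / rat_of_int (n * (n - 1) * (n - l - 1)))
      = H (k + 1) - H k" for k
  proof -
    have "rat_of_int (n - k - l - 2) / rat_of_int (n - l - 1)
         + rat_of_int ((l + 1) * n * k + l * (n - k - 2))
             / rat_of_int (n * (n - 1) * (n - l - 1))
      = interp L N (rat_of_int k + 1) - r * interp L N (rat_of_int k)"
      using summand_factor_conv_interp[OF nz, of "rat_of_int k"]
      by (simp add: N_def L_def r_def)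
    then show ?thesis
      by (simp add: H_def r_shift right_diff_distrib mult.assoc)
  qed
  have H_right: "H (n - 1) = N - 2"
    using interp_right[OF nz(3)] by (simp add: H_def N_def)
  have H_left: "H l = L * r powi (n - l - 2)"
    using nz by (simp add: H_def r_shift interp_left L_def[symmetric]) (simp add: r_def)
  have "(\<Sum>k = l..n - 2. H (k + 1) - H k) = H (n - 1) - H l"
    using sum_int_telescope[of l "n - 2" H] assms by simp
  then show ?thesis
    unfolding r_eq summand by (simp add: H_left H_right N_def L_def)
qed

end
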